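(* Let $w=(w_1,\dots,w_N)\in\{\prec,\succ,\prec',\succ'\}^N$ be a word and let $Z=(z_1,\dots,z_N)$ be nonnegative real parameters such that $z_iz_j<1$ whenever $i<j$ and $(w_i,w_j)\in\{(\prec,\succ),(\prec',\succ')\}$. Assume that Bernoulli and geometric random variables can be sampled in time $O(1)$. Then the time complexity of the algorithm SchurSample run on $(w,Z)$ (described in the context), which is random and depends on the output, is $O(|sh(w)|\,L)$, where $sh(w)$ is the encoded shape of the Schur process, and $$L:=\max\{\tau(l_i)_1,\ \ell(\tau(l_i)) : 0\le i\le m+n\}$$ is the maximum of the maximum part and the maximum number of parts of the partitions in the output sequence $\Lambda=(\tau(l_0),\dots,\tau(l_{m+n}))$.
   Context: **Partitions.** A partition $\lambda$ is a nonincreasing, eventually zero sequence $\lambda_1\ge\lambda_2\ge\cdots$ of nonnegative integers; $\ell(\lambda)$ is its number of positive parts, $|\lambda|=\sum_i\lambda_i$, $\emptyset$ is the zero partition, $\lambda'$ is the conjugate partition, $\lambda'_i=|\{j:\lambda_j\ge i\}|$. **Random variables.** $Geom(\xi)$, $0\le\xi<1$: $Prob(k)=(1-\xi)\xi^k$, $k=0,1,2,\dots$. $Bernoulli(p)$: value $1$ with probability $p$, value $0$ with probability $1-p$. All random draws in the algorithm are independent. **Atomic steps** (each takes partitions $\lambda,\mu,\kappa$ and a parameter $\xi\ge 0$ and returns a partition $\nu$; convention $\lambda_0=\infty$). - sampleHH$(\lambda,\mu,\kappa,\xi)$: draw $G\sim Geom(\xi)$; return $\nu$ with $\nu_1=\max(\lambda_1,\mu_1)+G$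 and $\nu_i=\max(\lambda_i,\mu_i)+\min(\lambda_{i-1},\mu_{i-1})-\kappa_{i-1}$ for $i>1$ ($\nu$ has at most $\max(\ell(\lambda),\ell(\mu))+1$ parts). - sampleVV$(\lambda,\mu,\kappa,\xi)$: return the conjugate of sampleHH$(\lambda',\mu',\kappa',\xi)$. - sampleHV$(\lambda,\mu,\kappa,\xi)$: draw $B\sim Bernoulli(\xi/(1+\xi))$. For $i=1,\dots,\max(\ell(\lambda),\ell(\mu))+1$ successively: if $\lambda_i\le\mu_i<\lambda_{i-1}$ set $\nu_i=\max(\lambda_i,\mu_i)+B$ with the current value of $B$, else set $\nu_i=\max(\lambda_i,\mu_i)$; then, if $\mu_{i+1}<\lambda_i\le\mu_i$, reassign $B:=\min(\lambda_i,\mu_i)-\kappa_i$. Return $\nu$ (further parts are $0$). - sampleVH$(\lambda,\mu,\kappa,\xi)$ := sampleHV$(\mu,\lambda,\kappa,\xi)$. **Precomputation.** Let $m$ (resp. $n$) be the number of letters of $w$ in $\{\prec,\prec'\}$ (resp. $\{\succ,\succ'\}$). Let $i_1<\dots<i_m$ be the positions of the letters in $\{\prec,\prec'\}$ and $j_n<\dots<j_1$ the positions of the letters in $\{\succ,\succ'\}$ (so $j_1$ is the rightmost). Set $u_k=w_{i_k}$, $x_k=z_{i_k}$ ($1\le k\le m$), $v_k=w_{j_k}$, $y_k=z_{j_k}$ ($1\le k\le n$). The encoded shape $\pi=sh(w)$ is the partition whose $j$-th part $\pi_j$ ($1\le j\le n$) is the number of letters of $w$ in $\{\prec,\prec'\}$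 lying to the left of the letter $v_j$. Its boxes are the pairs $(i,j)$ with $1\le j\le\ell(\pi)$, $1\le i\le\pi_j$. The type of the box $(i,j)$ is HH, VV, HV or VH according to whether $(u_i,v_j)$ is $(\prec,\succ)$, $(\prec',\succ')$, $(\prec,\succ')$ or $(\prec',\succ)$. **Algorithm SchurSample.** Start from $\tau(i,0)=\tau(0,j)=\emptyset$ for $0\le i\le m$, $0\le j\le n$. For $j=1,\dots,\ell(\pi)$, for $i=1,\dots,\pi_j$: set $\tau(i,j)=\mathrm{sample}T(\tau(i-1,j),\tau(i,j-1),\tau(i-1,j-1),x_iy_j)$, where $T\in\{HH,HV,VH,VV\}$ is the type of $(i,j)$. Output $\Lambda=(\tau(l_0),\tau(l_1),\dots,\tau(l_{m+n}))$, where $l_0=(0,n)$ and, for $k=1,\dots,m+n$, $l_k=l_{k-1}+(1,0)$ if $w_k\in\{\prec,\prec'\}$ and $l_k=l_{k-1}-(0,1)$ if $w_k\in\{\succ,\succ'\}$. (The algorithm samples the Schur process of word $w$ with parameters $Z$, i.e. the probability measure on sequences $\emptyset=\lambda(0),\lambda(1),\dots,\lambda(N)=\emptyset$ with $\lambda(i-1)\,w_i\,\lambda(i)$ for all $i$, proportional to $\prod_i z_i^{||\lambda(i)|-|\lambda(i-1)||}$; here $\lambda\succ\mu$, equivalently $\mu\prec\lambda$, means $\lambda_1\ge\mu_1\ge\lambda_2\ge\mu_2\ge\cdots$, and $\lambda\succ'\mu$, equivalently $\mu\prec'\lambda$, means $\lambda'\succ\mu'$.)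
   Formalization: The bound has max(1, L) instead of L (it fails when L = 0), and only the time of the double loop over the boxes is counted: precomputation, the initial empty entries and reading off the output, linear in N, are not charged (otherwise the bound fails for the word with all letters ≺). *)

theory Defs
  imports "HOL-Probability.Probability"
begin

section \<open>Randomized programs with running time\<close>

text \<open>
  A randomized program is the joint law of its result and of its running time.  The machine is a
  unit-cost random access machine: one iteration of a loop costs one unit, in addition to
  whatever its body costs, and pays for the boundedly many comparisons, additions, array
  accesses and array updates on natural numbers made in it.  A random draw costs what the
  supplied sampler says it costs.
\<close>

type_synonym 'a timed = "('a \<times> nat) pmf"

definition tret :: "'a \<Rightarrow> 'a timed" where
  "tret a = return_pmf (a, 0)"

definition tbind :: "'a timed \<Rightarrow> ('a \<Rightarrow> 'b timed) \<Rightarrow> 'b timed" (infixl \<open>\<rhd>\<close> 54) where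
  "M \<rhd> f = bind_pmf M (\<lambda>(a, s). map_pmf (\<lambda>(b, t). (b, s + t)) (f a))"

definition tick :: "'a timed \<Rightarrow> 'a timed" where
  "tick M = map_pmf (\<lambda>(a, t). (a, Suc t)) M"

primrec loop :: "'i list \<Rightarrow> ('i \<Rightarrow> 's \<Rightarrow> 's timed) \<Rightarrow> 's \<Rightarrow> 's timed" where
  "loop [] f s = tret s"
| "loop (i # is) f s = tick (f i s \<rhd> loop is f)"

text \<open>
  \<open>S\<close> samples, for every parameter in \<open>I\<close>, the distribution \<open>D\<close> in time \<open>O(1)\<close>,
  uniformly in the parameter.
\<close>

definition const_time_sampler ::
    "(real \<Rightarrow> 'a timed) \<Rightarrow> (real \<Rightarrow> 'a pmf) \<Rightarrow> real set \<Rightarrow> bool" where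
  "const_time_sampler S D I \<longleftrightarrow>
     (\<forall>\<xi>\<in>I. map_pmf fst (S \<xi>) = D \<xi>) \<and>
     (\<exists>c. \<forall>\<xi>\<in>I. \<forall>(v, t) \<in> set_pmf (S \<xi>). t \<le> c)"

text \<open>
  The library's \<^term>\<open>geometric_pmf p\<close> gives \<open>k\<close> the mass \<open>(1 - p) ^ k * p\<close>, so
  \<open>Geom(\<xi>)\<close> is its instance with \<open>p = 1 - \<xi>\<close>.
\<close>

definition geometric_sampler :: "(real \<Rightarrow> nat timed) \<Rightarrow> bool" where
  "geometric_sampler geo \<longleftrightarrow> const_time_sampler geo (\<lambda>\<xi>. geometric_pmf (1 - \<xi>)) {0..<1}"

definition bernoulli_sampler :: "(real \<Rightarrow> bool timed) \<Rightarrow> bool" where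
  "bernoulli_sampler ber \<longleftrightarrow> const_time_sampler ber bernoulli_pmf {0..1}"


section \<open>Partitions\<close>

text \<open>
  A partition is the sequence of its parts, indexed from \<open>1\<close>; index \<open>0\<close> carries no information
  and always holds \<open>0\<close> in the partitions constructed below.  A partition is stored as an array
  together with its number of parts, so \<open>plen\<close> is read in unit time.
\<close>

type_synonym parts = "nat \<Rightarrow> nat"

definition is_partition :: "parts \<Rightarrow> bool" where
  "is_partition lam \<longleftrightarrow> (\<forall>i\<ge>1. lam (i + 1) \<le> lam i) \<and> finite {i. 1 \<le> i \<and> 0 < lam i}"

definition empty_part :: parts where
  "empty_part = (\<lambda>_. 0)"

definition plen :: "parts \<Rightarrow> nat" where
  "plen lam = card {i. 1 \<le> i \<and> 0 < lam i}"

definition psize :: "parts \<Rightarrow> nat" where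
  "psize lam = (\<Sum>i = 1..plen lam. lam i)"

definition conjugate :: "parts \<Rightarrow> parts" where
  "conjugate lam i = (if i = 0 then 0 else card {j. 1 \<le> j \<and> i \<le> lam j})"

text \<open>
  Computation of the conjugate in time \<open>\<ell>(\<lambda>) + \<lambda>\<^sub>1\<close>: the parts of the conjugate with
  index in \<open>(\<lambda>\<^bsub>j+1\<^esub>, \<lambda>\<^sub>j]\<close> are equal to \<open>j\<close>; see \<open>conj_t_correct\<close>.
\<close>

definition conj_t :: "parts \<Rightarrow> parts timed" where
  "conj_t lam =
     loop [1..<plen lam + 1]
       (\<lambda>j. loop [lam (j + 1) + 1..<lam j + 1] (\<lambda>i nu. tret (nu(i := j))))
       empty_part"


section \<open>Atomic steps\<close>

definition sample_HH ::
    "(real \<Rightarrow> nat timed) \<Rightarrow> parts \<Rightarrow> parts \<Rightarrow> parts \<Rightarrow> real \<Rightarrow> parts timed" where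
  "sample_HH geo lam mu kap \<xi> =
     geo \<xi> \<rhd> (\<lambda>G.
       loop [1..<max (plen lam) (plen mu) + 2]
         (\<lambda>i nu. tret (nu(i :=
            (if i = 1 then max (lam 1) (mu 1) + G
             else max (lam i) (mu i) + min (lam (i - 1)) (mu (i - 1)) - kap (i - 1)))))
         empty_part)"

definition sample_VV ::
    "(real \<Rightarrow> nat timed) \<Rightarrow> parts \<Rightarrow> parts \<Rightarrow> parts \<Rightarrow> real \<Rightarrow> parts timed" where
  "sample_VV geo lam mu kap \<xi> =
     conj_t lam \<rhd> (\<lambda>lam'. conj_t mu \<rhd> (\<lambda>mu'. conj_t kap \<rhd> (\<lambda>kap'.
       sample_HH geo lam' mu' kap' \<xi> \<rhd> conj_t)))"

text \<open>The loop state is the pair of the array \<open>nu\<close> and the current value of \<open>B\<close>.\<close>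

definition sample_HV ::
    "(real \<Rightarrow> bool timed) \<Rightarrow> parts \<Rightarrow> parts \<Rightarrow> parts \<Rightarrow> real \<Rightarrow> parts timed" where
  "sample_HV ber lam mu kap \<xi> =
     ber (\<xi> / (1 + \<xi>)) \<rhd> (\<lambda>b.
       loop [1..<max (plen lam) (plen mu) + 2]
         (\<lambda>i (nu, B). tret
            (nu(i := (if lam i \<le> mu i \<and> (i = 1 \<or> mu i < lam (i - 1))
                      then max (lam i) (mu i) + B
                      else max (lam i) (mu i))),
             if mu (i + 1) < lam i \<and> lam i \<le> mu i
             then min (lam i) (mu i) - kap i else B))
         (empty_part, of_bool b)) \<rhd> (\<lambda>(nu, B). tret nu)"

definition sample_VH ::
    "(real \<Rightarrow> bool timed) \<Rightarrow> parts \<Rightarrow> parts \<Rightarrow> parts \<Rightarrow> real \<Rightarrow> parts timed" where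
  "sample_VH ber lam mu kap \<xi> = sample_HV ber mu lam kap \<xi>"


section \<open>Words and encoded shapes\<close>

text \<open>The letters are \<open>\<prec>\<close>, \<open>\<succ>\<close>, \<open>\<prec>'\<close>, \<open>\<succ>'\<close>, in this order.\<close>

datatype letter = Prec | Succ | Prec' | Succ'

definition is_prec :: "letter \<Rightarrow> bool" where
  "is_prec a \<longleftrightarrow> a \<in> {Prec, Prec'}"

text \<open>
  Positions in a word are counted from \<open>0\<close>.  The lists contain \<open>i\<^sub>1, \<dots>, i\<^sub>m\<close> (from left to
  right) and \<open>j\<^sub>1, \<dots>, j\<^sub>n\<close> (from right to left).
\<close>

definition prec_positions :: "letter list \<Rightarrow> nat list" where
  "prec_positions w = filter (\<lambda>p. is_prec (w ! p)) [0..<length w]"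

definition succ_positions :: "letter list \<Rightarrow> nat list" where
  "succ_positions w = rev (filter (\<lambda>p. \<not> is_prec (w ! p)) [0..<length w])"

definition prec_pos :: "letter list \<Rightarrow> nat \<Rightarrow> nat" where
  "prec_pos w k = prec_positions w ! (k - 1)"

definition succ_pos :: "letter list \<Rightarrow> nat \<Rightarrow> nat" where
  "succ_pos w k = succ_positions w ! (k - 1)"

definition encoded_shape :: "letter list \<Rightarrow> parts" where
  "encoded_shape w j =
     (if 1 \<le> j \<and> j \<le> length (succ_positions w)
      then card {p. p < succ_pos w j \<and> is_prec (w ! p)} else 0)"

definition schur_params :: "letter list \<Rightarrow> real list \<Rightarrow> bool" where
  "schur_params w Z \<longleftrightarrow>
     length Z = length w \<and> (\<forall>z\<in>set Z. 0 \<le> z) \<and>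
     (\<forall>i j. i < j \<and> j < length w \<and> (w ! i, w ! j) \<in> {(Prec, Succ), (Prec', Succ')}
        \<longrightarrow> Z ! i * Z ! j < 1)"


section \<open>The algorithm SchurSample\<close>

text \<open>The pair of letters is \<open>(u\<^sub>i, v\<^sub>j)\<close>; the last clause is never used.\<close>

fun sample_box ::
    "(real \<Rightarrow> nat timed) \<Rightarrow> (real \<Rightarrow> bool timed) \<Rightarrow> letter \<Rightarrow> letter \<Rightarrow>
     parts \<Rightarrow> parts \<Rightarrow> parts \<Rightarrow> real \<Rightarrow> parts timed" where
  "sample_box geo ber Prec Succ = sample_HH geo"
| "sample_box geo ber Prec' Succ' = sample_VV geo"
| "sample_box geo ber Prec Succ' = sample_HV ber"
| "sample_box geo ber Prec' Succ = sample_VH ber"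
| "sample_box geo ber _ _ = (\<lambda>lam mu kap \<xi>. tret empty_part)"

text \<open>
  The state is the table \<open>\<tau>\<close>, whose entries are \<open>\<emptyset>\<close> until they are written; in particular
  \<open>\<tau>(i,0) = \<tau>(0,j) = \<emptyset>\<close> throughout.
\<close>

definition fill_table ::
    "(real \<Rightarrow> nat timed) \<Rightarrow> (real \<Rightarrow> bool timed) \<Rightarrow> letter list \<Rightarrow> real list \<Rightarrow>
     (nat \<times> nat \<Rightarrow> parts) timed" where
  "fill_table geo ber w Z =
     loop [1..<plen (encoded_shape w) + 1]
       (\<lambda>j. loop [1..<encoded_shape w j + 1]
         (\<lambda>i \<tau>.
            sample_box geo ber (w ! prec_pos w i) (w ! succ_pos w j)
              (\<tau> (i - 1, j)) (\<tau> (i, j - 1)) (\<tau> (i - 1, j - 1))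
              (Z ! prec_pos w i * Z ! succ_pos w j)
            \<rhd> (\<lambda>nu. tret (\<tau>((i, j) := nu)))))
       (\<lambda>_. empty_part)"

text \<open>\<open>lattice_path w l\<^sub>0\<close> is the list \<open>l\<^sub>0, l\<^sub>1, \<dots>, l\<^bsub>m+n\<^esub>\<close>.\<close>

fun lattice_path :: "letter list \<Rightarrow> nat \<times> nat \<Rightarrow> (nat \<times> nat) list" where
  "lattice_path [] l = [l]"
| "lattice_path (a # w) (i, j) =
     (i, j) # lattice_path w (if is_prec a then (i + 1, j) else (i, j - 1))"

text \<open>
  The time is that of the sampling, that is, of the double loop over the boxes of the encoded
  shape with all the atomic steps called in it.  The precomputation of \<open>u\<close>, \<open>x\<close>, \<open>v\<close>, \<open>y\<close>
  and the encoded shape, the empty boundary entries of the table, and reading the output off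
  the table along the path are not charged: they take time linear in the length of the word,
  which is not bounded in terms of the encoded shape (for a word with the single letter \<open>\<prec>\<close>
  repeated, the shape is empty).
\<close>

definition schur_sample ::
    "(real \<Rightarrow> nat timed) \<Rightarrow> (real \<Rightarrow> bool timed) \<Rightarrow> letter list \<Rightarrow> real list \<Rightarrow>
     parts list timed" where
  "schur_sample geo ber w Z =
     fill_table geo ber w Z \<rhd>
       (\<lambda>\<tau>. tret (map \<tau> (lattice_path w (0, length (succ_positions w)))))"

definition max_extent :: "parts list \<Rightarrow> nat" where
  "max_extent \<Lambda> = Max ((\<lambda>lam. lam 1) ` set \<Lambda> \<union> plen ` set \<Lambda>)"


section \<open>Correctness of the computation of conjugates\<close>

lemma tret_tbind: "tret a \<rhd> f = f a"
  by (simp add: tret_def tbind_def bind_return_pmf map_pmf_def case_prod_unfold bind_return_pmf')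

lemma loop_det:
  assumes "\<And>i s. i \<in> set is \<Longrightarrow> f i s = return_pmf (g i s, c i)"
  shows "loop is f s = return_pmf (fold g is s, (\<Sum>i\<leftarrow>is. Suc (c i)))"
  using assms
  by (induction "is" arbitrary: s)
     (simp_all add: tret_def tbind_def tick_def bind_return_pmf)

lemma fold_upd_const:
  "fold (\<lambda>i nu. nu(i := c)) xs nu = (\<lambda>i. if i \<in> set xs then c else nu i)"
  by (induction xs arbitrary: nu) (auto simp: fun_eq_iff)

lemma is_partition_antimono:
  assumes "is_partition lam" "1 \<le> i" "i \<le> j"
  shows "lam j \<le> lam i"
  using assms(3,2)
proof (induction j rule: dec_induct)
  case (step k)
  then have "lam (k + 1) \<le> lam k" using assms(1) by (simp add: is_partition_def)
  with step show ?case by simp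
qed simp

lemma is_partition_positive_parts:
  assumes "is_partition lam"
  shows "{i. 1 \<le> i \<and> 0 < lam i} = {1..plen lam}"
proof -
  let ?A = "{i. 1 \<le> i \<and> 0 < lam i}"
  have fin: "finite ?A" using assms by (simp add: is_partition_def)
  define M where "M = Max (insert 0 ?A)"
  have "?A = {1..M}"
  proof (intro equalityI subsetI)
    fix i assume "i \<in> ?A"
    moreover from this have "i \<le> M" unfolding M_def using fin by (intro Max_ge) auto
    ultimately show "i \<in> {1..M}" by simp
  next
    fix i assume i: "i \<in> {1..M}"
    have "M \<in> insert 0 ?A" unfolding M_def using fin by (intro Max_in) auto
    with i have "0 < lam M" by auto
    with is_partition_antimono[OF assms, of i M] i show "i \<in> ?A" by auto
  qed
  then show ?thesis by (simp add: plen_def)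
qed

lemma conj_t_fold:
  assumes "is_partition lam"
  shows "fold (\<lambda>j nu i. if lam (j + 1) < i \<and> i \<le> lam j then j else nu i) [1..<k + 1] empty_part
           = (\<lambda>i. if i \<le> lam (k + 1) then 0 else card {j. 1 \<le> j \<and> j \<le> k \<and> i \<le> lam j})"
proof (induction k)
  case 0
  show ?case by (auto simp: empty_part_def fun_eq_iff)
next
  case (Suc k)
  let ?g = "\<lambda>j nu i. if lam (j + 1) < i \<and> i \<le> lam j then j else nu i"
  have mono: "lam (k + 2) \<le> lam (k + 1)"
    using is_partition_antimono[OF assms, of "k + 1" "k + 2"] by simp
  have "fold ?g [1..<Suc k + 1] empty_part = ?g (k + 1) (fold ?g [1..<k + 1] empty_part)"
  proof -
    have "[1..<Suc k + 1] = [1..<k + 1] @ [k + 1]" by simp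
    then show ?thesis by (simp only: fold_append fold.simps o_apply id_apply)
  qed
  also have "\<dots> = ?g (k + 1)
      (\<lambda>i. if i \<le> lam (k + 1) then 0 else card {j. 1 \<le> j \<and> j \<le> k \<and> i \<le> lam j})"
    by (simp only: Suc.IH)
  also have "\<dots> = (\<lambda>i. if i \<le> lam (Suc k + 1) then 0
      else card {j. 1 \<le> j \<and> j \<le> Suc k \<and> i \<le> lam j})"
  proof
    fix i
    show "?g (k + 1)
        (\<lambda>i. if i \<le> lam (k + 1) then 0 else card {j. 1 \<le> j \<and> j \<le> k \<and> i \<le> lam j}) i =
      (if i \<le> lam (Suc k + 1) then 0 else card {j. 1 \<le> j \<and> j \<le> Suc k \<and> i \<le> lam j})"
    proof (cases "i \<le> lam (k + 1)")
      case True
      have "i \<le> lam j" if "1 \<le> j" "j \<le> Suc k" for j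
        using is_partition_antimono[OF assms, of j "k + 1"] that True by simp
      then have "{j. 1 \<le> j \<and> j \<le> Suc k \<and> i \<le> lam j} = {1..Suc k}" by auto
      then have "card {j. 1 \<le> j \<and> j \<le> Suc k \<and> i \<le> lam j} = Suc k" by simp
      with True mono show ?thesis by simp
    next
      case False
      then have "{j. 1 \<le> j \<and> j \<le> Suc k \<and> i \<le> lam j} = {j. 1 \<le> j \<and> j \<le> k \<and> i \<le> lam j}"
        by (auto simp: le_Suc_eq)
      with False mono show ?thesis by simp
    qed
  qed
  finally show ?case .
qed

lemma conj_t_correct:
  assumes "is_partition lam"
  shows "conj_t lam = return_pmf (conjugate lam, plen lam + lam 1)"
proof -
  have pos: "1 \<le> i \<and> 0 < lam i \<longleftrightarrow> 1 \<le> i \<and> i \<le> plen lam" for i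
    using is_partition_positive_parts[OF assms] by (auto simp: set_eq_iff)
  let ?g = "\<lambda>j nu i. if lam (j + 1) < i \<and> i \<le> lam j then j else nu i"
  let ?c = "\<lambda>j. lam j - lam (j + 1)"
  have inner: "loop [lam (j + 1) + 1..<lam j + 1] (\<lambda>i nu. tret (nu(i := j))) s
      = return_pmf (?g j s, ?c j)" for j s
    by (subst loop_det[where g = "\<lambda>i nu. nu(i := j)" and c = "\<lambda>_. 0"])
       (auto simp: tret_def fold_upd_const fun_eq_iff sum_list_triv)
  have zero: "lam (plen lam + 1) = 0" using pos[of "plen lam + 1"] by simp
  have time: "(\<Sum>j\<leftarrow>[1..<k + 1]. Suc (?c j)) + lam (k + 1) = k + lam 1" for k
  proof (induction k)
    case (Suc k)
    have "lam (k + 2) \<le> lam (k + 1)"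
      using is_partition_antimono[OF assms, of "k + 1" "k + 2"] by simp
    with Suc show ?case by simp
  qed simp
  have "conj_t lam = return_pmf (fold ?g [1..<plen lam + 1] empty_part,
      \<Sum>j\<leftarrow>[1..<plen lam + 1]. Suc (?c j))"
    unfolding conj_t_def by (rule loop_det) (rule inner)
  also have "fold ?g [1..<plen lam + 1] empty_part = conjugate lam"
  proof -
    have "{j. 1 \<le> j \<and> j \<le> plen lam \<and> i \<le> lam j} = {j. 1 \<le> j \<and> i \<le> lam j}" if "i \<noteq> 0" for i
    proof (intro Collect_cong iffI conjI; elim conjE)
      fix j assume "1 \<le> j" "i \<le> lam j"
      with that have "1 \<le> j \<and> 0 < lam j" by simp
      with pos[of j] show "j \<le> plen lam" by blast
    qed
    then show ?thesis
      unfolding conj_t_fold[OF assms] zero by (auto simp: conjugate_def fun_eq_iff)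
  qed
  finally show ?thesis using time[of "plen lam"] zero by simp
qed

end

theory Submission
  imports Defs
begin

text \<open>
  The cost of a single box is at most a constant times the extent (the larger of the first part
  and the number of parts) of the partitions that the box reads and writes: the scan over the
  parts takes one unit per part, and a conjugate takes \<open>\<ell>(\<lambda>) + \<lambda>\<^sub>1\<close> units.  So the theorem
  holds because the extent of every intermediate partition is bounded by that of some partition
  of the output.

  This rests on the invariant that makes the algorithm meaningful.  If \<open>\<kappa> \<subseteq> \<mu>\<close> is a strip of the kind
  prescribed by \<open>u\<close> and \<open>\<kappa> \<subseteq> \<lambda>\<close> a strip of the kind prescribed by \<open>v\<close>, then every partition \<open>\<nu>\<close>
  which the atomic step for \<open>(u, v)\<close> can return is such that \<open>\<lambda> \<subseteq> \<nu>\<close> is a strip of the kind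
  of \<open>u\<close> and \<open>\<mu> \<subseteq> \<nu>\<close> one of the kind of \<open>v\<close> (\<open>sample_box_surely\<close>).  The strip conditions are
  what the subtractions in the atomic steps need to be nonnegative and the result to be a
  partition again, and they carry over to the next boxes because \<open>u\<close> depends on the column only
  and \<open>v\<close> on the row only.

  In particular the table increases along each row.  Row \<open>j\<close> ends at the box \<open>(\<pi>\<^sub>j, j)\<close>, which
  is the point of the lattice path just before the letter \<open>v\<^sub>j\<close> and hence carries a partition of
  the output.  Therefore each of the \<open>\<pi>\<^sub>j\<close> boxes of the row costs \<open>O(L)\<close>, and the sum over the
  rows is \<open>O(|\<pi>| L)\<close>.
\<close>


section \<open>Almost sure properties of timed programs\<close>

text \<open>
  All the laws involved are discrete, so a property holds almost surely exactly if it holds on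
  the support.  The following rules form a Hoare logic in which the assertions also speak of the
  running time.
\<close>

definition surely :: "'a timed \<Rightarrow> ('a \<Rightarrow> nat \<Rightarrow> bool) \<Rightarrow> bool" where
  "surely M Q \<longleftrightarrow> (\<forall>(a, t) \<in> set_pmf M. Q a t)"

lemma surely_mono:
  assumes "surely M P" and "\<And>a t. P a t \<Longrightarrow> Q a t"
  shows "surely M Q"
  using assms by (auto simp: surely_def)

lemma surely_return [simp]: "surely (return_pmf (a, t)) Q \<longleftrightarrow> Q a t"
  by (simp add: surely_def)

lemma surely_tret [simp]: "surely (tret a) Q \<longleftrightarrow> Q a 0"
  by (simp add: tret_def)

lemma surely_tbind: "surely (M \<rhd> f) Q \<longleftrightarrow> surely M (\<lambda>a s. surely (f a) (\<lambda>b t. Q b (s + t)))"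
  by (fastforce simp: surely_def tbind_def)

lemma surely_tick: "surely (tick M) Q \<longleftrightarrow> surely M (\<lambda>a t. Q a (Suc t))"
  by (fastforce simp: surely_def tick_def)

lemma surely_loop_upt:
  assumes ab: "a \<le> b" and init: "Inv a s 0"
    and step: "\<And>i s t. a \<le> i \<Longrightarrow> i < b \<Longrightarrow> Inv i s t \<Longrightarrow>
                 surely (f i s) (\<lambda>s' t'. Inv (Suc i) s' (t + Suc t'))"
  shows "surely (loop [a..<b] f s) (Inv b)"
proof -
  have "surely (loop [k..<b] f s) (\<lambda>s' t'. Inv b s' (t + t'))"
    if "k \<le> b" "a \<le> k" "Inv k s t" for k s t
    using that
  proof (induction k arbitrary: s t rule: inc_induct)
    case base
    then show ?case by simp
  next
    case (step k)
    have "surely (f k s) (\<lambda>s' t'. Inv (Suc k) s' (t + Suc t'))"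
      using step.hyps step.prems by (intro assms(3)) auto
    then show ?case
      using step.hyps step.prems
      by (auto simp: upt_conv_Cons surely_tick surely_tbind add.assoc
            elim!: surely_mono dest: step.IH[rotated])
  qed
  from this[of a s 0] ab init show ?thesis by simp
qed


section \<open>Strips and extents of partitions\<close>

lemma is_partitionI:
  assumes "\<And>i. 1 \<le> i \<Longrightarrow> lam (i + 1) \<le> lam i" and "\<And>i. n < i \<Longrightarrow> lam i = 0"
  shows "is_partition lam"
proof -
  have "{i. 1 \<le> i \<and> 0 < lam i} \<subseteq> {..n}"
    using assms(2) by (metis (mono_tags, lifting) atMost_iff mem_Collect_eq not_less
        less_numeral_extra(3) subsetI)
  then show ?thesis
    using assms(1) by (auto simp: is_partition_def intro: finite_subset)
qed

lemma is_partition_empty_part [simp]: "is_partition empty_part"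
  by (simp add: is_partition_def empty_part_def)

lemma part_pos_iff:
  assumes "is_partition lam" and "1 \<le> i"
  shows "0 < lam i \<longleftrightarrow> i \<le> plen lam"
  using is_partition_positive_parts[OF assms(1)] assms(2) by (auto simp: set_eq_iff)

lemma part_eq_0:
  assumes "is_partition lam" and "plen lam < i"
  shows "lam i = 0"
  using part_pos_iff[OF assms(1), of i] assms(2) by simp

lemma plen_mono:
  assumes "is_partition nu" and "\<And>i. 1 \<le> i \<Longrightarrow> lam i \<le> nu i"
  shows "plen lam \<le> plen nu"
proof -
  have "{i. 1 \<le> i \<and> 0 < lam i} \<subseteq> {i. 1 \<le> i \<and> 0 < nu i}"
    using assms(2) by (auto intro: less_le_trans)
  moreover have "finite {i. 1 \<le> i \<and> 0 < nu i}"
    using assms(1) by (simp add: is_partition_def)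
  ultimately show ?thesis
    unfolding plen_def by (rule card_mono[rotated])
qed

text \<open>
  The floor \<open>1\<close> covers the empty partition: a box costs at least one unit even if everything in
  it is empty.
\<close>

definition extent :: "parts \<Rightarrow> nat" where
  "extent lam = max 1 (max (lam 1) (plen lam))"

lemma extent_ge: "1 \<le> extent lam" "lam 1 \<le> extent lam" "plen lam \<le> extent lam"
  by (auto simp: extent_def)

lemma extent_mono:
  assumes "is_partition nu" and "\<And>i. 1 \<le> i \<Longrightarrow> lam i \<le> nu i"
  shows "extent lam \<le> extent nu"
  using plen_mono[OF assms] assms(2)[of 1] by (auto simp: extent_def)

definition hstrip :: "parts \<Rightarrow> parts \<Rightarrow> bool" where
  "hstrip mu lam \<longleftrightarrow> (\<forall>i\<ge>1. mu i \<le> lam i \<and> lam (i + 1) \<le> mu i)"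

definition vstrip :: "parts \<Rightarrow> parts \<Rightarrow> bool" where
  "vstrip mu lam \<longleftrightarrow> (\<forall>i\<ge>1. mu i \<le> lam i \<and> lam i \<le> mu i + 1)"

text \<open>
  The orientation of the letter is dropped: \<open>\<prec>\<close> and \<open>\<succ>\<close> (resp. \<open>\<prec>'\<close> and \<open>\<succ>'\<close>) give the same
  relation, with the smaller partition as first argument.
\<close>

definition strip :: "letter \<Rightarrow> parts \<Rightarrow> parts \<Rightarrow> bool" where
  "strip a = (if a \<in> {Prec, Succ} then hstrip else vstrip)"

lemma strip_le: "strip a mu lam \<Longrightarrow> 1 \<le> i \<Longrightarrow> mu i \<le> lam i"
  by (auto simp: strip_def hstrip_def vstrip_def split: if_splits)

lemma strip_refl_empty [simp]: "strip a empty_part empty_part"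
  by (simp add: strip_def hstrip_def vstrip_def empty_part_def)

lemma extent_strip: "strip a mu lam \<Longrightarrow> is_partition lam \<Longrightarrow> extent mu \<le> extent lam"
  by (rule extent_mono) (auto dest: strip_le)


section \<open>Conjugation\<close>

text \<open>
  Both sides say that the box in row \<open>j\<close> and column \<open>i\<close> lies in the diagram.  This Galois
  connection spares the comparison of conjugates any counting.
\<close>

lemma le_conjugate_iff:
  assumes "is_partition lam" and "1 \<le> i" and "1 \<le> j"
  shows "j \<le> conjugate lam i \<longleftrightarrow> i \<le> lam j"
proof -
  define A where "A = {k. 1 \<le> k \<and> i \<le> lam k}"
  have "finite A"
    using assms(1,2) by (auto simp: A_def is_partition_def elim!: finite_subset[rotated])
  have down: "k \<in> A" if "1 \<le> k" "k \<le> l" "l \<in> A" for k l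
    using is_partition_antimono[OF assms(1), of k l] that by (auto simp: A_def)
  show ?thesis
  proof
    assume "i \<le> lam j"
    then have "{1..j} \<subseteq> A" using down[of _ j] assms(3) by (auto simp: A_def)
    from card_mono[OF \<open>finite A\<close> this] show "j \<le> conjugate lam i"
      using assms(2) by (simp add: conjugate_def A_def)
  next
    assume *: "j \<le> conjugate lam i"
    show "i \<le> lam j"
    proof (rule ccontr)
      assume "\<not> i \<le> lam j"
      then have "j \<notin> A" by (simp add: A_def)
      then have "l < j" if "l \<in> A" for l
        using down[OF assms(3) _ that] by (meson not_less)
      then have "A \<subseteq> {1..<j}" by (auto simp: A_def)
      from card_mono[OF _ this] assms(3) * assms(2) show False
        by (simp add: conjugate_def A_def)
    qed
  qed
qed

lemma conjugate_leI:
  assumes "is_partition lam" and "1 \<le> i" and "\<And>j. 1 \<le> j \<Longrightarrow> i \<le> lam j \<Longrightarrow> j \<le> n"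
  shows "conjugate lam i \<le> n"
proof (cases "conjugate lam i = 0")
  case False
  then show ?thesis
    using assms(3)[of "conjugate lam i"] le_conjugate_iff[OF assms(1,2), of "conjugate lam i"]
    by simp
qed simp

lemma conjugate_1: "conjugate lam 1 = plen lam"
  by (simp add: conjugate_def plen_def Suc_le_eq)

lemma is_partition_conjugate:
  assumes "is_partition lam"
  shows "is_partition (conjugate lam)"
proof (rule is_partitionI[where n = "lam 1"])
  fix i :: nat assume i: "1 \<le> i"
  show "conjugate lam (i + 1) \<le> conjugate lam i"
    using i by (intro conjugate_leI[OF assms]) (auto simp: le_conjugate_iff[OF assms])
next
  fix i assume i: "lam 1 < i"
  have "lam j \<le> lam 1" if "1 \<le> j" for j
    using is_partition_antimono[OF assms, of 1 j] that by simp
  then have "conjugate lam i \<le> 0"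
    using i by (intro conjugate_leI[OF assms]) (auto dest: le_less_trans)
  then show "conjugate lam i = 0" by simp
qed

lemma conjugate_conjugate:
  assumes "is_partition lam" and "1 \<le> i"
  shows "conjugate (conjugate lam) i = lam i"
proof -
  have *: "j \<le> conjugate (conjugate lam) i \<longleftrightarrow> j \<le> lam i" if "1 \<le> j" for j
    using le_conjugate_iff[OF is_partition_conjugate[OF assms(1)] assms(2) that]
      le_conjugate_iff[OF assms(1) that assms(2)] by simp
  show ?thesis
    using *[of "lam i"] *[of "conjugate (conjugate lam) i"]
    by (cases "lam i = 0"; cases "conjugate (conjugate lam) i = 0") auto
qed

lemma extent_conjugate:
  assumes "is_partition lam"
  shows "extent (conjugate lam) = extent lam"
proof -
  have "plen (conjugate lam) = lam 1"
    using conjugate_1[of "conjugate lam"] conjugate_conjugate[OF assms, of 1] by simp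
  then show ?thesis
    by (simp add: extent_def conjugate_1[unfolded One_nat_def] max.commute)
qed

lemma hstrip_conjugate:
  assumes "is_partition mu" and "is_partition lam" and "vstrip mu lam"
  shows "hstrip (conjugate mu) (conjugate lam)"
  unfolding hstrip_def
proof (intro allI impI conjI)
  fix i :: nat assume i: "1 \<le> i"
  show "conjugate mu i \<le> conjugate lam i"
    using assms(3) i
    by (intro conjugate_leI[OF assms(1)])
       (auto simp: le_conjugate_iff[OF assms(2)] vstrip_def intro: le_trans)
  show "conjugate lam (i + 1) \<le> conjugate mu i"
    using assms(3) i
    by (intro conjugate_leI[OF assms(2)])
       (fastforce simp: le_conjugate_iff[OF assms(1)] vstrip_def)+
qed

lemma vstrip_conjugate:
  assumes "is_partition mu" and "is_partition lam" and "hstrip mu lam"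
  shows "vstrip (conjugate mu) (conjugate lam)"
  unfolding vstrip_def
proof (intro allI impI conjI)
  fix i :: nat assume i: "1 \<le> i"
  show "conjugate mu i \<le> conjugate lam i"
    using assms(3) i
    by (intro conjugate_leI[OF assms(1)])
       (auto simp: le_conjugate_iff[OF assms(2)] hstrip_def intro: le_trans)
  show "conjugate lam i \<le> conjugate mu i + 1"
  proof (rule conjugate_leI[OF assms(2) i])
    fix j assume j: "1 \<le> j" "i \<le> lam j"
    show "j \<le> conjugate mu i + 1"
    proof (cases "j = 1")
      case False
      then have "lam j \<le> mu (j - 1)"
        using assms(3) j(1) unfolding hstrip_def by (auto dest!: spec[of _ "j - 1"])
      then have "j - 1 \<le> conjugate mu i"
        using j False i by (subst le_conjugate_iff[OF assms(1)]) auto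
      then show ?thesis by simp
    qed simp
  qed
qed

lemma surely_conj_t:
  assumes "is_partition lam"
  shows "surely (conj_t lam) Q \<longleftrightarrow> Q (conjugate lam) (plen lam + lam 1)"
  by (simp add: conj_t_correct[OF assms])


section \<open>The atomic steps\<close>

lemma hstrip_is_partition:
  assumes "hstrip mu lam" and "\<And>i. n < i \<Longrightarrow> lam i = 0"
  shows "is_partition lam"
  using assms by (intro is_partitionI) (auto simp: hstrip_def intro: le_trans)

lemma scan_time:
  assumes "is_partition nu" and "\<And>i. 1 \<le> i \<Longrightarrow> max (lam i) (mu i) \<le> nu i" and "s \<le> c"
  shows "s + (max (plen lam) (plen mu) + 1) \<le> (c + 2) * extent nu"
proof -
  have "max (plen lam) (plen mu) \<le> plen nu"
    using plen_mono[OF assms(1)] assms(2) by (metis max.bounded_iff)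
  then have "max (plen lam) (plen mu) + 1 \<le> extent nu + extent nu"
    using extent_ge(1,3)[of nu] by linarith
  moreover have "s \<le> c * extent nu"
    using assms(3) extent_ge(1)[of nu] by (metis le_trans mult.right_neutral mult_le_mono2)
  ultimately show ?thesis by (simp add: algebra_simps)
qed

text \<open>
  The interlacing of \<open>\<kappa>\<close> with \<open>\<lambda>\<close> and \<open>\<mu>\<close> reads
  \<open>max(\<lambda>\<^bsub>i+1\<^esub>, \<mu>\<^bsub>i+1\<^esub>) \<le> \<kappa>\<^sub>i \<le> min(\<lambda>\<^sub>i, \<mu>\<^sub>i)\<close>.  The upper bound on \<open>\<kappa>\<^sub>i\<close> gives
  \<open>\<nu>\<^bsub>i+1\<^esub> \<ge> max(\<lambda>\<^bsub>i+1\<^esub>, \<mu>\<^bsub>i+1\<^esub>)\<close>, and the lower bound gives \<open>\<nu>\<^bsub>i+1\<^esub> \<le> min(\<lambda>\<^sub>i, \<mu>\<^sub>i)\<close>.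
\<close>

lemma sample_HH_surely:
  assumes part: "is_partition lam" "is_partition mu"
    and strips: "hstrip kap mu" "hstrip kap lam"
    and geo: "surely (geo \<xi>) (\<lambda>_ t. t \<le> c)"
  shows "surely (sample_HH geo lam mu kap \<xi>)
           (\<lambda>nu t. is_partition nu \<and> hstrip lam nu \<and> hstrip mu nu \<and> t \<le> (c + 2) * extent nu)"
proof -
  define N where "N = max (plen lam) (plen mu) + 2"
  define h where "h G i = (if i = 1 then max (lam 1) (mu 1) + G
      else max (lam i) (mu i) + min (lam (i - 1)) (mu (i - 1)) - kap (i - 1))" for G i :: nat
  define nu where "nu G i = (if 1 \<le> i \<and> i < N then h G i else 0)" for G i
  have loop: "surely (loop [1..<N] (\<lambda>i nu. tret (nu(i := h G i))) empty_part)
      (\<lambda>nu' t. nu' = nu G \<and> t = N - 1)" for G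
  proof -
    have "surely (loop [1..<N] (\<lambda>i nu. tret (nu(i := h G i))) empty_part)
        (\<lambda>nu' t. nu' = (\<lambda>i. if 1 \<le> i \<and> i < N then h G i else 0) \<and> t = N - 1)"
      by (rule surely_loop_upt) (auto simp: N_def empty_part_def fun_eq_iff)
    then show ?thesis by (simp add: nu_def[abs_def])
  qed
  have zero: "lam i = 0" "mu i = 0" if "N \<le> i + 1" for i
    using that by (auto simp: N_def intro!: part_eq_0[OF part(1)] part_eq_0[OF part(2)])
  have lower: "max (lam i) (mu i) \<le> nu G i" if i: "1 \<le> i" for G i
  proof (cases "i < N")
    case True
    have "kap (i - 1) \<le> min (lam (i - 1)) (mu (i - 1))" if "i \<noteq> 1"
      using strips i that by (auto simp: hstrip_def)
    then show ?thesis
      using True i by (cases "i = 1") (simp_all add: nu_def h_def, linarith)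
  qed (use zero[of i] in \<open>simp\<close>)
  have upper: "nu G (i + 1) \<le> min (lam i) (mu i)" if i: "1 \<le> i" for G i
  proof -
    have "max (lam (i + 1)) (mu (i + 1)) \<le> kap i"
      using strips i by (simp add: hstrip_def)
    then show ?thesis using i by (auto simp: nu_def h_def)
  qed
  have strip_nu: "hstrip lam (nu G)" "hstrip mu (nu G)" for G
    using lower upper by (auto simp: hstrip_def)
  have part_nu: "is_partition (nu G)" for G
    by (rule hstrip_is_partition[OF strip_nu(1), where n = N]) (simp add: nu_def)
  note nu = part_nu strip_nu
  have time: "s + (N - 1) \<le> (c + 2) * extent (nu G)" if "s \<le> c" for s G
    using scan_time[OF part_nu[of G], of lam mu s c] lower[of _ G] that by (simp add: N_def)
  have "surely (geo \<xi> \<rhd> (\<lambda>G. loop [1..<N] (\<lambda>i nu. tret (nu(i := h G i))) empty_part))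
      (\<lambda>nu t. is_partition nu \<and> hstrip lam nu \<and> hstrip mu nu \<and> t \<le> (c + 2) * extent nu)"
    unfolding surely_tbind
    by (rule surely_mono[OF geo], rule surely_mono[OF loop]) (use nu time in auto)
  then show ?thesis by (simp add: sample_HH_def N_def h_def)
qed

text \<open>
  Conjugation exchanges the two kinds of strips and preserves extents, so the conjugated step
  inherits everything; the conjugations cost at most \<open>2\<close> extents each.
\<close>

lemma sample_VV_surely:
  assumes part: "is_partition lam" "is_partition mu" "is_partition kap"
    and strips: "vstrip kap mu" "vstrip kap lam"
    and geo: "surely (geo \<xi>) (\<lambda>_ t. t \<le> c)"
  shows "surely (sample_VV geo lam mu kap \<xi>)
           (\<lambda>nu t. is_partition nu \<and> vstrip lam nu \<and> vstrip mu nu \<and> t \<le> (c + 10) * extent nu)"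
proof -
  note conj = is_partition_conjugate
  have HH: "surely (sample_HH geo (conjugate lam) (conjugate mu) (conjugate kap) \<xi>)
      (\<lambda>nu t. is_partition nu \<and> hstrip (conjugate lam) nu \<and> hstrip (conjugate mu) nu
         \<and> t \<le> (c + 2) * extent nu)"
    using part strips geo by (intro sample_HH_surely conj hstrip_conjugate)
  have post: "vstrip alpha (conjugate nu)"
    if "is_partition alpha" "is_partition nu" "hstrip (conjugate alpha) nu" for alpha nu
    using vstrip_conjugate[OF conj[OF that(1)] that(2,3)] conjugate_conjugate[OF that(1)]
    by (simp add: vstrip_def)
  have le: "plen alpha + alpha 1 \<le> 2 * extent alpha" for alpha
    using extent_ge(2,3)[of alpha] by simp
  have time: "plen lam + lam 1 + (plen mu + mu 1 + (plen kap + kap 1 + (t + (plen nu + nu 1))))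
      \<le> (c + 10) * extent (conjugate nu)"
    if nu: "is_partition nu" "hstrip (conjugate lam) nu" "hstrip (conjugate mu) nu"
      and t: "t \<le> (c + 2) * extent nu" for nu t
  proof -
    have "extent kap \<le> extent lam"
      using strips(2) part(1) by (intro extent_mono) (auto simp: vstrip_def)
    moreover have "extent lam \<le> extent nu" "extent mu \<le> extent nu"
      using post nu part extent_conjugate[OF nu(1)] conj[OF nu(1)]
      by (metis extent_mono vstrip_def)+
    ultimately have "plen lam + lam 1 + (plen mu + mu 1 + (plen kap + kap 1 + (plen nu + nu 1)))
        \<le> 8 * extent nu"
      using le[of lam] le[of mu] le[of kap] le[of nu] by linarith
    with t have "plen lam + lam 1 + (plen mu + mu 1 + (plen kap + kap 1 + (t + (plen nu + nu 1))))
        \<le> (c + 2) * extent nu + 8 * extent nu"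
      by linarith
    also have "\<dots> = (c + 10) * extent nu" by (simp add: algebra_simps)
    finally show ?thesis by (simp add: extent_conjugate[OF nu(1)])
  qed
  have "surely (sample_HH geo (conjugate lam) (conjugate mu) (conjugate kap) \<xi> \<rhd> conj_t)
      (\<lambda>nu t. is_partition nu \<and> vstrip lam nu \<and> vstrip mu nu \<and>
         plen lam + lam 1 + (plen mu + mu 1 + (plen kap + kap 1 + t)) \<le> (c + 10) * extent nu)"
    unfolding surely_tbind
    by (rule surely_mono[OF HH]) (use part post time conj in \<open>auto simp: surely_conj_t\<close>)
  then show ?thesis
    by (simp add: sample_VV_def surely_tbind surely_conj_t part)
qed

text \<open>
  The carried value \<open>B\<close> never exceeds \<open>1\<close>: it is a bit at first, and is only replaced by
  \<open>\<lambda>\<^sub>i - \<kappa>\<^sub>i\<close>, which is at most \<open>1\<close> in a vertical strip.  Adding it cannot break \<open>\<nu>\<^bsub>i\<^esub> \<le> \<lambda>\<^bsub>i-1\<^esub>\<close>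
  since it is added only where \<open>\<mu>\<^sub>i < \<lambda>\<^bsub>i-1\<^esub>\<close>.
\<close>

lemma sample_HV_surely:
  assumes part: "is_partition lam" "is_partition mu"
    and strips: "hstrip kap mu" "vstrip kap lam"
    and ber: "surely (ber (\<xi> / (1 + \<xi>))) (\<lambda>_ t. t \<le> c)"
  shows "surely (sample_HV ber lam mu kap \<xi>)
           (\<lambda>nu t. is_partition nu \<and> hstrip lam nu \<and> vstrip mu nu \<and> t \<le> (c + 2) * extent nu)"
proof -
  define N where "N = max (plen lam) (plen mu) + 2"
  define body where "body = (\<lambda>i (nu :: parts, B). tret
            (nu(i := (if lam i \<le> mu i \<and> (i = 1 \<or> mu i < lam (i - 1))
                      then max (lam i) (mu i) + B
                      else max (lam i) (mu i))),
             if mu (i + 1) < lam i \<and> lam i \<le> mu i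
             then min (lam i) (mu i) - kap i else B))"
  define good where "good i nu k \<longleftrightarrow>
      (if 1 \<le> k \<and> k < i
       then max (lam k) (mu k) \<le> nu k \<and> nu k \<le> mu k + 1 \<and> (k \<noteq> 1 \<longrightarrow> nu k \<le> lam (k - 1))
       else nu k = 0)" for i k and nu :: parts
  have kap_mu: "kap i \<le> mu i" "mu (i + 1) \<le> kap i"
    and kap_lam: "kap i \<le> lam i" "lam i \<le> kap i + 1" if "1 \<le> i" for i
    using strips that by (auto simp: hstrip_def vstrip_def)
  define Inv where "Inv i s t \<longleftrightarrow> snd s \<le> 1 \<and> (\<forall>k. good i (fst s) k) \<and> t = i - 1"
    for i t and s :: "parts \<times> nat"
  have loop: "surely (loop [1..<N] body (empty_part, of_bool b)) (Inv N)" for b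
  proof (rule surely_loop_upt)
    fix i t and s :: "parts \<times> nat"
    assume i: "1 \<le> i" "i < N" and "Inv i s t"
    then obtain nu B where s: "s = (nu, B)" and B: "B \<le> 1" and nu: "\<And>k. good i nu k"
      and t: "t = i - 1"
      by (cases s) (auto simp: Inv_def)
    define x where "x = (if lam i \<le> mu i \<and> (i = 1 \<or> mu i < lam (i - 1))
      then max (lam i) (mu i) + B else max (lam i) (mu i))"
    have "mu i \<le> lam (i - 1)" "lam i \<le> lam (i - 1)" if "i \<noteq> 1"
      using kap_mu(2)[of "i - 1"] kap_lam(1)[of "i - 1"] is_partition_antimono[OF part(1), of "i - 1" i]
        that i by (simp_all, linarith)
    moreover have "lam i \<le> mu i + 1"
      using kap_mu(1)[OF i(1)] kap_lam(2)[OF i(1)] by simp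
    ultimately have x: "max (lam i) (mu i) \<le> x" "x \<le> mu i + 1" "i \<noteq> 1 \<longrightarrow> x \<le> lam (i - 1)"
      using B by (auto simp: x_def)
    have "good (Suc i) (nu(i := x)) k" for k
      using nu[of k] x i by (cases "k = i") (auto simp: good_def less_Suc_eq)
    moreover have "min (lam i) (mu i) - kap i \<le> 1"
      using kap_lam(2)[OF i(1)] by linarith
    ultimately show "surely (body i s) (\<lambda>s' t'. Inv (Suc i) s' (t + Suc t'))"
      using B i t unfolding s body_def by (auto simp: Inv_def x_def)
  qed (auto simp: Inv_def good_def N_def empty_part_def)
  have zero: "lam i = 0" "mu i = 0" if "N \<le> i + 1" for i
    using that by (auto simp: N_def intro!: part_eq_0[OF part(1)] part_eq_0[OF part(2)])
  have final: "is_partition nu \<and> hstrip lam nu \<and> vstrip mu nu \<and> s + t \<le> (c + 2) * extent nu"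
    if inv: "Inv N (nu, B) t" and s: "s \<le> c" for nu B s t
  proof -
    have good: "good N nu k" for k using inv by (simp add: Inv_def)
    have lower: "max (lam k) (mu k) \<le> nu k" "nu k \<le> mu k + 1" if "1 \<le> k" for k
      using good[of k] zero[of k] that by (auto simp: good_def split: if_splits)
    have upper: "nu (k + 1) \<le> lam k" if "1 \<le> k" for k
      using good[of "k + 1"] that by (auto simp: good_def split: if_splits)
    have h: "hstrip lam nu" and v: "vstrip mu nu"
      using lower upper by (auto simp: hstrip_def vstrip_def)
    have p: "is_partition nu"
      by (rule hstrip_is_partition[OF h, where n = N]) (use good in \<open>auto simp: good_def\<close>)
    have "t = max (plen lam) (plen mu) + 1" using inv by (simp add: Inv_def N_def)
    with scan_time[OF p lower(1) s] p h v show ?thesis by simp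
  qed
  have "surely (ber (\<xi> / (1 + \<xi>)) \<rhd> (\<lambda>b. loop [1..<N] body (empty_part, of_bool b))
      \<rhd> (\<lambda>(nu, B). tret nu))
      (\<lambda>nu t. is_partition nu \<and> hstrip lam nu \<and> vstrip mu nu \<and> t \<le> (c + 2) * extent nu)"
    unfolding surely_tbind
    by (rule surely_mono[OF ber], rule surely_mono[OF loop]) (use final in auto)
  then show ?thesis by (simp add: sample_HV_def N_def body_def)
qed

text \<open>
  With \<open>\<lambda>\<close> and \<open>\<mu>\<close> interchanged, the hypotheses and conclusions for the types VH and HV are the
  same.  The bound on the geometric sampler is asked for only at boxes that draw from it, as
  \<open>\<xi> < 1\<close> is guaranteed only there.
\<close>

lemma sample_box_surely:
  assumes part: "is_partition lam" "is_partition mu" "is_partition kap"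
    and strips: "strip u kap mu" "strip v kap lam"
    and letters: "is_prec u" "\<not> is_prec v"
    and geo: "(u, v) \<in> {(Prec, Succ), (Prec', Succ')} \<Longrightarrow> surely (geo \<xi>) (\<lambda>_ t. t \<le> c)"
    and ber: "surely (ber (\<xi> / (1 + \<xi>))) (\<lambda>_ t. t \<le> c)"
  shows "surely (sample_box geo ber u v lam mu kap \<xi>)
           (\<lambda>nu t. is_partition nu \<and> strip u lam nu \<and> strip v mu nu \<and> t \<le> (c + 10) * extent nu)"
proof -
  have c: "t \<le> (c + 2) * e \<Longrightarrow> t \<le> (c + 10) * e" for t e
    by (erule order_trans) (rule mult_le_mono1, simp)
  consider "u = Prec" "v = Succ" | "u = Prec'" "v = Succ'" | "u = Prec" "v = Succ'"
    | "u = Prec'" "v = Succ"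
    using letters by (cases u; cases v) (auto simp: is_prec_def)
  then show ?thesis
  proof cases
    case 1
    with strips geo show ?thesis
      using sample_HH_surely[OF part(1,2), of kap geo \<xi> c]
      by (auto simp: strip_def elim!: surely_mono intro: c)
  next
    case 2
    with strips geo show ?thesis
      using sample_VV_surely[OF part, of geo \<xi> c] by (simp add: strip_def)
  next
    case 3
    with strips show ?thesis
      using sample_HV_surely[where ber = ber and \<xi> = \<xi>, OF part(1,2) _ _ ber, of kap]
      by (auto simp: strip_def elim!: surely_mono intro: c)
  next
    case 4
    with strips show ?thesis
      using sample_HV_surely[where ber = ber and \<xi> = \<xi>, OF part(2,1) _ _ ber, of kap]
      by (auto simp: strip_def sample_VH_def elim!: surely_mono intro: c)
  qed
qed


section \<open>The encoded shape\<close>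

lemma card_less_imp_less:
  fixes a b :: nat
  assumes "card {q. q < a \<and> P q} < card {q. q < b \<and> P q}"
  shows "a < b"
proof (rule ccontr)
  assume "\<not> a < b"
  then have "{q. q < b \<and> P q} \<subseteq> {q. q < a \<and> P q}" by auto
  from card_mono[OF _ this] assms show False by simp
qed

lemma nth_filter_upt:
  assumes "k < length (filter P [0..<N])"
  shows "filter P [0..<N] ! k < N" "P (filter P [0..<N] ! k)"
    "card {q. q < filter P [0..<N] ! k \<and> P q} = k"
proof -
  let ?xs = "filter P [0..<N]"
  have "?xs ! k \<in> set ?xs" using assms by (rule nth_mem)
  then show N: "?xs ! k < N" and "P (?xs ! k)" by auto
  have sorted: "sorted_wrt (<) ?xs" by (simp add: sorted_wrt_filter)
  have less: "?xs ! i < ?xs ! j \<longleftrightarrow> i < j" if "i < length ?xs" "j < length ?xs" for i j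
    using sorted_wrt_nth_less[OF sorted] that by (metis linorder_neqE_nat order_less_asym order_less_irrefl)
  have "{q. q < ?xs ! k \<and> P q} = (!) ?xs ` {..<k}"
  proof (intro equalityI subsetI)
    fix q assume q: "q \<in> {q. q < ?xs ! k \<and> P q}"
    with N have "q \<in> set ?xs" by auto
    then obtain i where "i < length ?xs" "q = ?xs ! i" by (metis in_set_conv_nth)
    with q less[of i k] assms show "q \<in> (!) ?xs ` {..<k}" by auto
  next
    fix q assume "q \<in> (!) ?xs ` {..<k}"
    then obtain i where i: "i < k" "q = ?xs ! i" by auto
    with less[of i k] assms nth_mem[of i ?xs] show "q \<in> {q. q < ?xs ! k \<and> P q}" by auto
  qed
  moreover have "inj_on ((!) ?xs) {..<k}"
    using assms by (intro inj_on_nth) auto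
  ultimately show "card {q. q < ?xs ! k \<and> P q} = k" by (simp add: card_image)
qed

lemma succ_pos_props:
  assumes "1 \<le> j" and "j \<le> length (succ_positions w)"
  shows "succ_pos w j < length w" "\<not> is_prec (w ! succ_pos w j)"
    "card {q. q < succ_pos w j \<and> \<not> is_prec (w ! q)} + j = length (succ_positions w)"
proof -
  let ?xs = "filter (\<lambda>p. \<not> is_prec (w ! p)) [0..<length w]"
  have "length ?xs - j < length ?xs" using assms by (simp add: succ_positions_def)
  note nth_filter_upt[OF this]
  moreover have "succ_pos w j = ?xs ! (length ?xs - j)"
    using assms by (simp add: succ_pos_def succ_positions_def rev_nth)
  ultimately show "succ_pos w j < length w" "\<not> is_prec (w ! succ_pos w j)"
    "card {q. q < succ_pos w j \<and> \<not> is_prec (w ! q)} + j = length (succ_positions w)"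
    using assms by (simp_all add: succ_positions_def)
qed

lemma prec_pos_props:
  assumes "1 \<le> i" and "i \<le> encoded_shape w j"
  shows "prec_pos w i < succ_pos w j" "is_prec (w ! prec_pos w i)"
proof -
  let ?xs = "filter (\<lambda>p. is_prec (w ! p)) [0..<length w]"
  have j: "1 \<le> j" "j \<le> length (succ_positions w)"
    and i: "i \<le> card {q. q < succ_pos w j \<and> is_prec (w ! q)}"
    using assms by (auto simp: encoded_shape_def split: if_splits)
  have "{q. q < succ_pos w j \<and> is_prec (w ! q)} \<subseteq> set ?xs"
    using succ_pos_props(1)[OF j] by auto
  from card_mono[OF _ this] have "i \<le> card (set ?xs)" using i by simp
  then have len: "i - 1 < length ?xs"
    using card_length[of ?xs] assms(1) by linarith
  then show "is_prec (w ! prec_pos w i)"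
    unfolding prec_pos_def prec_positions_def by (rule nth_filter_upt)
  have "card {q. q < prec_pos w i \<and> is_prec (w ! q)} = i - 1"
    unfolding prec_pos_def prec_positions_def by (rule nth_filter_upt[OF len])
  with i assms(1) show "prec_pos w i < succ_pos w j"
    by - (rule card_less_imp_less[where P = "\<lambda>q. is_prec (w ! q)"], simp)
qed

text \<open>
  The letters \<open>\<succ>\<close>, \<open>\<succ>'\<close> are numbered from right to left, so the next one has fewer letters to its left.
\<close>

lemma is_partition_encoded_shape: "is_partition (encoded_shape w)"
proof (rule is_partitionI[where n = "length (succ_positions w)"])
  fix j :: nat assume j: "1 \<le> j"
  show "encoded_shape w (j + 1) \<le> encoded_shape w j"
  proof (cases "j + 1 \<le> length (succ_positions w)")
    case True
    have "succ_pos w (j + 1) < succ_pos w j"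
      using succ_pos_props(3)[of "j + 1" w] succ_pos_props(3)[of j w] True j
      by - (rule card_less_imp_less[where P = "\<lambda>q. \<not> is_prec (w ! q)"], simp)
    with True j show ?thesis
      by (auto simp: encoded_shape_def intro!: card_mono)
  qed (simp add: encoded_shape_def)
qed (simp add: encoded_shape_def)

text \<open>
  The point reached after \<open>p\<close> letters: the first coordinate has gone up, and the second one down,
  by the number of letters of the respective orientation among them.
\<close>

lemma lattice_path_mem:
  assumes "p \<le> length w"
  shows "(i + card {q. q < p \<and> is_prec (w ! q)}, j - card {q. q < p \<and> \<not> is_prec (w ! q)})
           \<in> set (lattice_path w (i, j))"
  using assms
proof (induction w arbitrary: i j p)
  case (Cons a w)
  show ?case
  proof (cases p)
    case (Suc r)
    have split: "card {q. q < Suc r \<and> P ((a # w) ! q)} = of_bool (P a) + card {q. q < r \<and> P (w ! q)}"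
      for P
    proof -
      have "{q. q < Suc r \<and> P ((a # w) ! q)} = {q. q = 0 \<and> P a} \<union> Suc ` {q. q < r \<and> P (w ! q)}"
        by (auto simp: image_iff less_Suc_eq_0_disj)
      also have "card \<dots> = card {q :: nat. q = 0 \<and> P a} + card (Suc ` {q. q < r \<and> P (w ! q)})"
        by (rule card_Un_disjoint) auto
      finally show ?thesis by (auto simp: card_image)
    qed
    have "r \<le> length w" using Cons.prems Suc by simp
    from Cons.IH[OF this, of "i + 1" j] Cons.IH[OF this, of i "j - 1"] show ?thesis
      unfolding Suc split[of is_prec] split[of "\<lambda>a. \<not> is_prec a"]
      by (cases "is_prec a") auto
  qed simp
qed simp

lemma row_end_on_path:
  assumes "1 \<le> j" and "j \<le> plen (encoded_shape w)"
  shows "(encoded_shape w j, j) \<in> set (lattice_path w (0, length (succ_positions w)))"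
proof -
  have "0 < encoded_shape w j"
    using part_pos_iff[OF is_partition_encoded_shape assms(1)] assms(2) by simp
  then have j: "j \<le> length (succ_positions w)"
    by (simp add: encoded_shape_def split: if_splits)
  have "length (succ_positions w) - card {q. q < succ_pos w j \<and> \<not> is_prec (w ! q)} = j"
    using succ_pos_props(3)[OF assms(1) j] by simp
  then show ?thesis
    using lattice_path_mem[of "succ_pos w j" w 0 "length (succ_positions w)"]
      succ_pos_props(1)[OF assms(1) j] assms(1) j
    by (simp add: encoded_shape_def)
qed


section \<open>Filling the table\<close>

definition boxes_before :: "letter list \<Rightarrow> nat \<Rightarrow> nat \<Rightarrow> (nat \<times> nat) set" where
  "boxes_before w i j =
     {(a, b). 1 \<le> a \<and> 1 \<le> b \<and> a \<le> encoded_shape w b \<and> (b < j \<or> b = j \<and> a < i)}"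

text \<open>
  The invariant of the table when exactly the boxes in \<open>D\<close> have been written: along both
  directions consecutive entries form the strips prescribed by the letters.
\<close>

definition consistent :: "letter list \<Rightarrow> (nat \<times> nat) set \<Rightarrow> (nat \<times> nat \<Rightarrow> parts) \<Rightarrow> bool" where
  "consistent w D \<tau> \<longleftrightarrow>
     (\<forall>l. is_partition (\<tau> l)) \<and> (\<forall>l. l \<notin> D \<longrightarrow> \<tau> l = empty_part) \<and>
     (\<forall>i j. (i, j) \<in> D \<longrightarrow> strip (w ! prec_pos w i) (\<tau> (i - 1, j)) (\<tau> (i, j)) \<and>
                           strip (w ! succ_pos w j) (\<tau> (i, j - 1)) (\<tau> (i, j)))"

lemma boxes_before_Suc:
  assumes "1 \<le> i" and "i \<le> encoded_shape w j" and "1 \<le> j"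
  shows "boxes_before w (Suc i) j = insert (i, j) (boxes_before w i j)"
  using assms by (auto simp: boxes_before_def less_Suc_eq)

lemma boxes_before_row_end:
  "boxes_before w (encoded_shape w j + 1) j = boxes_before w 1 (Suc j)"
  by (auto simp: boxes_before_def less_Suc_eq)

lemma consistent_below_box:
  assumes cons: "consistent w (boxes_before w i j) \<tau>"
    and ij: "1 \<le> i" "i \<le> encoded_shape w j" "1 \<le> j"
  shows "strip (w ! prec_pos w i) (\<tau> (i - 1, j - 1)) (\<tau> (i, j - 1))"
    and "strip (w ! succ_pos w j) (\<tau> (i - 1, j - 1)) (\<tau> (i - 1, j))"
proof -
  have empty: "\<tau> (0, b) = empty_part" "\<tau> (a, 0) = empty_part" for a b
    using cons by (simp_all add: consistent_def boxes_before_def)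
  show "strip (w ! prec_pos w i) (\<tau> (i - 1, j - 1)) (\<tau> (i, j - 1))"
  proof (cases "j = 1")
    case False
    have "encoded_shape w j \<le> encoded_shape w (j - 1)"
      using False ij by (intro is_partition_antimono[OF is_partition_encoded_shape]) auto
    then have "(i, j - 1) \<in> boxes_before w i j"
      using False ij by (auto simp: boxes_before_def)
    with cons show ?thesis by (simp add: consistent_def)
  qed (simp add: empty)
  show "strip (w ! succ_pos w j) (\<tau> (i - 1, j - 1)) (\<tau> (i - 1, j))"
  proof (cases "i = 1")
    case False
    then have "(i - 1, j) \<in> boxes_before w i j"
      using ij by (auto simp: boxes_before_def)
    with cons show ?thesis by (simp add: consistent_def)
  qed (simp add: empty)
qed

text \<open>
  Writing a box leaves the strips at earlier boxes intact: the entries compared there are the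
  earlier box and its two neighbours of smaller index, none of which is the box written now.
\<close>

lemma consistent_write:
  assumes cons: "consistent w (boxes_before w i j) \<tau>"
    and ij: "1 \<le> i" "i \<le> encoded_shape w j" "1 \<le> j"
    and nu: "is_partition nu" "strip (w ! prec_pos w i) (\<tau> (i - 1, j)) nu"
      "strip (w ! succ_pos w j) (\<tau> (i, j - 1)) nu"
  shows "consistent w (boxes_before w (Suc i) j) (\<tau>((i, j) := nu))"
proof -
  let ?\<tau>' = "\<tau>((i, j) := nu)"
  have keep: "?\<tau>' (a, b) = \<tau> (a, b)" "?\<tau>' (a - 1, b) = \<tau> (a - 1, b)"
      "?\<tau>' (a, b - 1) = \<tau> (a, b - 1)"
    if "(a, b) \<in> boxes_before w i j" for a b
    using that ij by (auto simp: boxes_before_def)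
  have new: "?\<tau>' (i, j) = nu" "?\<tau>' (i - 1, j) = \<tau> (i - 1, j)" "?\<tau>' (i, j - 1) = \<tau> (i, j - 1)"
    using ij by auto
  have strips: "strip (w ! prec_pos w a) (?\<tau>' (a - 1, b)) (?\<tau>' (a, b)) \<and>
      strip (w ! succ_pos w b) (?\<tau>' (a, b - 1)) (?\<tau>' (a, b))"
    if "(a, b) \<in> insert (i, j) (boxes_before w i j)" for a b
  proof (cases "(a, b) = (i, j)")
    case True
    then have "a = i" "b = j" by simp_all
    with nu(2,3) show ?thesis by (simp only: new)
  next
    case False
    with that have ab: "(a, b) \<in> boxes_before w i j" by blast
    with cons show ?thesis unfolding keep[OF ab] consistent_def by blast
  qed
  have "is_partition (?\<tau>' l)" for l
    using conjunct1[OF cons[unfolded consistent_def], rule_format, of l] nu(1) by auto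
  moreover have "?\<tau>' l = empty_part" if "l \<notin> insert (i, j) (boxes_before w i j)" for l
    using conjunct1[OF conjunct2[OF cons[unfolded consistent_def]], rule_format, of l] that by auto
  ultimately show ?thesis
    unfolding boxes_before_Suc[OF ij] consistent_def using strips by blast
qed

text \<open>
  The extents in a row increase, so the cost of the boxes written so far is bounded by their
  number times the extent of the last one.
\<close>

lemma fill_row_surely:
  assumes cons: "consistent w (boxes_before w 1 j) \<tau>\<^sub>0"
    and j: "1 \<le> j" "j \<le> plen (encoded_shape w)"
    and box: "\<And>i lam mu kap. 1 \<le> i \<Longrightarrow> i \<le> encoded_shape w j \<Longrightarrow>
        is_partition lam \<Longrightarrow> is_partition mu \<Longrightarrow> is_partition kap \<Longrightarrow>
        strip (w ! prec_pos w i) kap mu \<Longrightarrow> strip (w ! succ_pos w j) kap lam \<Longrightarrow>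
        surely (f i lam mu kap)
          (\<lambda>nu t. is_partition nu \<and> strip (w ! prec_pos w i) lam nu \<and>
             strip (w ! succ_pos w j) mu nu \<and> t \<le> K * extent nu)"
  shows "surely (loop [1..<encoded_shape w j + 1]
            (\<lambda>i \<tau>. f i (\<tau> (i - 1, j)) (\<tau> (i, j - 1)) (\<tau> (i - 1, j - 1))
                   \<rhd> (\<lambda>nu. tret (\<tau>((i, j) := nu)))) \<tau>\<^sub>0)
           (\<lambda>\<tau> t. consistent w (boxes_before w 1 (Suc j)) \<tau> \<and>
              (\<forall>i b. b < j \<longrightarrow> \<tau> (i, b) = \<tau>\<^sub>0 (i, b)) \<and>
              t \<le> encoded_shape w j * ((K + 1) * extent (\<tau> (encoded_shape w j, j))))"
proof -
  define Inv where "Inv i \<tau> t \<longleftrightarrow> consistent w (boxes_before w i j) \<tau> \<and>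
      (\<forall>i b. b < j \<longrightarrow> \<tau> (i, b) = \<tau>\<^sub>0 (i, b)) \<and>
      t \<le> (i - 1) * ((K + 1) * extent (\<tau> (i - 1, j)))" for i t and \<tau> :: "nat \<times> nat \<Rightarrow> parts"
  have "surely (loop [1..<encoded_shape w j + 1]
            (\<lambda>i \<tau>. f i (\<tau> (i - 1, j)) (\<tau> (i, j - 1)) (\<tau> (i - 1, j - 1))
                   \<rhd> (\<lambda>nu. tret (\<tau>((i, j) := nu)))) \<tau>\<^sub>0) (Inv (encoded_shape w j + 1))"
  proof (rule surely_loop_upt)
    fix i \<tau> t assume "1 \<le> i" "i < encoded_shape w j + 1" and inv: "Inv i \<tau> t"
    then have i: "1 \<le> i" "i \<le> encoded_shape w j" by simp_all
    have cons: "consistent w (boxes_before w i j) \<tau>"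
      and t: "t \<le> (i - 1) * ((K + 1) * extent (\<tau> (i - 1, j)))"
      using inv by (simp_all add: Inv_def)
    have part: "is_partition (\<tau> l)" for l using cons unfolding consistent_def by blast
    have "Inv (Suc i) (\<tau>((i, j) := nu)) (t + Suc s)"
      if nu: "is_partition nu" "strip (w ! prec_pos w i) (\<tau> (i - 1, j)) nu"
        "strip (w ! succ_pos w j) (\<tau> (i, j - 1)) nu" "s \<le> K * extent nu" for nu s
    proof -
      have "t \<le> (i - 1) * ((K + 1) * extent nu)"
        using t extent_strip[OF nu(2,1)] by (meson le_trans mult_le_mono2)
      moreover have "Suc s \<le> (K + 1) * extent nu"
        using nu(4) extent_ge(1)[of nu] by simp
      ultimately have "t + Suc s \<le> (i - 1) * ((K + 1) * extent nu) + (K + 1) * extent nu"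
        by (rule add_mono)
      also have "\<dots> = i * ((K + 1) * extent nu)"
        using i by (cases i) simp_all
      finally show ?thesis
        using inv consistent_write[OF cons i j(1) nu(1-3)] by (simp add: Inv_def)
    qed
    then show "surely (f i (\<tau> (i - 1, j)) (\<tau> (i, j - 1)) (\<tau> (i - 1, j - 1))
          \<rhd> (\<lambda>nu. tret (\<tau>((i, j) := nu)))) (\<lambda>\<tau>' t'. Inv (Suc i) \<tau>' (t + Suc t'))"
      using surely_mono[OF box[OF i part part part consistent_below_box[OF cons i j(1)]]]
      by (simp add: surely_tbind)
  qed (use cons in \<open>simp_all add: Inv_def\<close>)
  then show ?thesis
    by (rule surely_mono) (simp add: Inv_def boxes_before_row_end[simplified])
qed

lemma fill_table_surely:
  assumes Z: "schur_params w Z"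
    and geo: "\<And>\<xi>. 0 \<le> \<xi> \<Longrightarrow> \<xi> < 1 \<Longrightarrow> surely (geo \<xi>) (\<lambda>_ t. t \<le> c)"
    and ber: "\<And>p. 0 \<le> p \<Longrightarrow> p \<le> 1 \<Longrightarrow> surely (ber p) (\<lambda>_ t. t \<le> c)"
  shows "surely (fill_table geo ber w Z)
           (\<lambda>\<tau> t. t \<le> (\<Sum>j = 1..plen (encoded_shape w).
              encoded_shape w j * ((c + 12) * extent (\<tau> (encoded_shape w j, j)))))"
proof -
  let ?pi = "encoded_shape w"
  define T where "T j \<tau> = (\<Sum>b = 1..<j. ?pi b * ((c + 12) * extent (\<tau> (?pi b, b))))"
    for j and \<tau> :: "nat \<times> nat \<Rightarrow> parts"
  have "surely (fill_table geo ber w Z)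
      (\<lambda>\<tau> t. consistent w (boxes_before w 1 (plen ?pi + 1)) \<tau> \<and> t \<le> T (plen ?pi + 1) \<tau>)"
    unfolding fill_table_def
  proof (rule surely_loop_upt)
    fix j \<tau>\<^sub>0 t\<^sub>0
    assume "1 \<le> j" "j < plen ?pi + 1"
      and inv: "consistent w (boxes_before w 1 j) \<tau>\<^sub>0 \<and> t\<^sub>0 \<le> T j \<tau>\<^sub>0"
    then have j: "1 \<le> j" "j \<le> plen ?pi" by simp_all
    have pos: "0 < ?pi j"
      using part_pos_iff[OF is_partition_encoded_shape j(1)] j(2) by simp
    then have "j \<le> length (succ_positions w)"
      by (simp add: encoded_shape_def split: if_splits)
    note succ = succ_pos_props(1,2)[OF j(1) this]
    have box: "surely (sample_box geo ber (w ! prec_pos w i) (w ! succ_pos w j) lam mu kap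
          (Z ! prec_pos w i * Z ! succ_pos w j))
        (\<lambda>nu t. is_partition nu \<and> strip (w ! prec_pos w i) lam nu \<and>
           strip (w ! succ_pos w j) mu nu \<and> t \<le> (c + 10) * extent nu)"
      if i: "1 \<le> i" "i \<le> ?pi j"
        and part: "is_partition lam" "is_partition mu" "is_partition kap"
        and strips: "strip (w ! prec_pos w i) kap mu" "strip (w ! succ_pos w j) kap lam"
      for i lam mu kap
    proof (rule sample_box_surely[OF part strips prec_pos_props(2)[OF i] succ(2)])
      let ?xi = "Z ! prec_pos w i * Z ! succ_pos w j"
      have less: "prec_pos w i < succ_pos w j" by (rule prec_pos_props(1)[OF i])
      then have nonneg: "0 \<le> ?xi"
        using Z succ(1) by (simp add: schur_params_def)
      show "surely (ber (?xi / (1 + ?xi))) (\<lambda>_ t. t \<le> c)"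
        using nonneg by (intro ber) (simp_all add: divide_le_eq_1)
      show "surely (geo ?xi) (\<lambda>_ t. t \<le> c)"
        if "(w ! prec_pos w i, w ! succ_pos w j) \<in> {(Prec, Succ), (Prec', Succ')}"
        using that Z less succ(1) by (intro geo[OF nonneg]) (simp add: schur_params_def)
    qed
    have "consistent w (boxes_before w 1 (Suc j)) \<tau> \<and> t\<^sub>0 + Suc t \<le> T (Suc j) \<tau>"
      if cons: "consistent w (boxes_before w 1 (Suc j)) \<tau>"
        and old: "\<forall>i b. b < j \<longrightarrow> \<tau> (i, b) = \<tau>\<^sub>0 (i, b)"
        and t: "t \<le> ?pi j * ((c + 10 + 1) * extent (\<tau> (?pi j, j)))" for \<tau> t
    proof -
      have "T j \<tau>\<^sub>0 = T j \<tau>" using old by (simp add: T_def)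
      moreover have "Suc t \<le> ?pi j * ((c + 12) * extent (\<tau> (?pi j, j)))"
      proof -
        (* the unit paid for the row itself is charged to one of its boxes *)
        have "1 \<le> ?pi j * extent (\<tau> (?pi j, j))"
          using pos extent_ge(1)[of "\<tau> (?pi j, j)"] by (simp add: Suc_le_eq)
        moreover have "?pi j * ((c + 12) * extent (\<tau> (?pi j, j)))
            = ?pi j * ((c + 10 + 1) * extent (\<tau> (?pi j, j))) + ?pi j * extent (\<tau> (?pi j, j))"
          by (simp add: algebra_simps)
        ultimately show ?thesis using t by linarith
      qed
      ultimately show ?thesis
        using inv cons j(1) by (simp add: T_def)
    qed
    then show "surely (loop [1..<?pi j + 1]
         (\<lambda>i \<tau>. sample_box geo ber (w ! prec_pos w i) (w ! succ_pos w j)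
              (\<tau> (i - 1, j)) (\<tau> (i, j - 1)) (\<tau> (i - 1, j - 1))
              (Z ! prec_pos w i * Z ! succ_pos w j)
            \<rhd> (\<lambda>nu. tret (\<tau>((i, j) := nu)))) \<tau>\<^sub>0)
        (\<lambda>\<tau> t. consistent w (boxes_before w 1 (Suc j)) \<tau> \<and> t\<^sub>0 + Suc t \<le> T (Suc j) \<tau>)"
      using inv
      by (intro surely_mono[OF fill_row_surely[where K = "c + 10" and f = "\<lambda>i lam mu kap.
            sample_box geo ber (w ! prec_pos w i) (w ! succ_pos w j) lam mu kap
              (Z ! prec_pos w i * Z ! succ_pos w j)", OF _ j box]]) auto
  qed (auto simp: consistent_def boxes_before_def T_def)
  then show ?thesis
    by (rule surely_mono) (simp add: T_def atLeastLessThanSuc_atLeastAtMost)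
qed

lemma const_time_samplerD:
  assumes "const_time_sampler S D I"
  obtains c where "\<And>\<xi>. \<xi> \<in> I \<Longrightarrow> surely (S \<xi>) (\<lambda>_ t. t \<le> c)"
  using assms by (fastforce simp: const_time_sampler_def surely_def)

lemma extent_le_max_extent:
  assumes "lam \<in> set \<Lambda>"
  shows "extent lam \<le> max 1 (max_extent \<Lambda>)"
proof -
  have "lam 1 \<le> max_extent \<Lambda>" "plen lam \<le> max_extent \<Lambda>"
    using assms unfolding max_extent_def by (auto intro!: Max_ge)
  then show ?thesis by (auto simp: extent_def)
qed

theorem proposition3p6:
  fixes geo :: "real \<Rightarrow> nat timed" and ber :: "real \<Rightarrow> bool timed"
  assumes "geometric_sampler geo" and "bernoulli_sampler ber"
  shows "\<exists>C :: nat. \<forall>(w :: letter list) (Z :: real list). schur_params w Z \<longrightarrow>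
           (\<forall>(\<Lambda>, t) \<in> set_pmf (schur_sample geo ber w Z).
              t \<le> C * (psize (encoded_shape w) * max 1 (max_extent \<Lambda>)))"
proof -
  obtain g where g: "\<And>\<xi>. \<xi> \<in> {0..<1} \<Longrightarrow> surely (geo \<xi>) (\<lambda>_ t. t \<le> g)"
    using const_time_samplerD[OF assms(1)[unfolded geometric_sampler_def]] by blast
  obtain b where b: "\<And>p. p \<in> {0..1} \<Longrightarrow> surely (ber p) (\<lambda>_ t. t \<le> b)"
    using const_time_samplerD[OF assms(2)[unfolded bernoulli_sampler_def]] by blast
  define c where "c = max g b"
  have geo: "surely (geo \<xi>) (\<lambda>_ t. t \<le> c)" if "0 \<le> \<xi>" "\<xi> < 1" for \<xi>
    by (rule surely_mono[OF g]) (use that in \<open>auto simp: c_def\<close>)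
  have ber: "surely (ber p) (\<lambda>_ t. t \<le> c)" if "0 \<le> p" "p \<le> 1" for p
    by (rule surely_mono[OF b]) (use that in \<open>auto simp: c_def\<close>)
  have "surely (schur_sample geo ber w Z)
      (\<lambda>\<Lambda> t. t \<le> (c + 12) * (psize (encoded_shape w) * max 1 (max_extent \<Lambda>)))"
    if Z: "schur_params w Z" for w Z
  proof -
    let ?pi = "encoded_shape w"
    define out where "out \<tau> = map \<tau> (lattice_path w (0, length (succ_positions w)))"
      for \<tau> :: "nat \<times> nat \<Rightarrow> parts"
    have "(\<Sum>j = 1..plen ?pi. ?pi j * ((c + 12) * extent (\<tau> (?pi j, j))))
        \<le> (c + 12) * (psize ?pi * max 1 (max_extent (out \<tau>)))" for \<tau>
    proof -
      have "(\<Sum>j = 1..plen ?pi. ?pi j * ((c + 12) * extent (\<tau> (?pi j, j))))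
          \<le> (\<Sum>j = 1..plen ?pi. ?pi j * ((c + 12) * max 1 (max_extent (out \<tau>))))"
        by (intro sum_mono mult_le_mono2 extent_le_max_extent)
           (auto simp: out_def intro!: imageI row_end_on_path)
      also have "\<dots> = (c + 12) * (psize ?pi * max 1 (max_extent (out \<tau>)))"
        by (simp add: psize_def sum_distrib_left sum_distrib_right mult_ac)
      finally show ?thesis .
    qed
    then show ?thesis
      unfolding schur_sample_def surely_tbind
      by (intro surely_mono[OF fill_table_surely[OF Z geo ber]])
         (auto simp: out_def intro: order_trans)
  qed
  then show ?thesis unfolding surely_def by blast
qed

end
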